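(* There is a polynomial $p$ such that for every $n>1$ and every choice of functions $r,s:[n]^3\to[n]$ satisfying the guard conditions below, the set of clauses $\mathrm{GGT}_n$ (built with these $r,s$) has a tree-like regular resolution refutation with input lemmas having at most $p(n)$ clauses. (In short: the guarded graph tautology principles $\mathrm{GGT}_n$ have polynomial size tree-like regular resolution refutations with input lemmas.)
   Context: Let $[n]=\{0,1,\dots,n-1\}$. The propositional variables are $x_{i,j}$ for $i,j\in[n]$, $i\neq j$, with the convention that $x_{i,j}$ and $\overline x_{j,i}$ (the negation of $x_{j,i}$) are the same literal. A clause is a set of literals (read as their disjunction); $\Box$ denotes the empty clause. For distinct $i,j,k$ let $T_{i,j,k}=\overline x_{i,j}\lor\overline x_{j,k}\lor\overline x_{k,i}$. Let $r,s:[n]^3\to[n]$ be functions such that for all distinct $i,j,k$: $r(i,j,k)\neq s(i,j,k)$, $\{r(i,j,k),s(i,j,k)\}\not\subseteq\{i,j,k\}$, and $r(i,j,k)=r(j,k,i)=r(k,i,j)$ and likewise for $s$. The guarded graph tautology $\mathrm{GGT}_n$ consists of: (a) for each $i<n$ the clause $\bigvee_{j\neq i}x_{j,i}$; (b) for all distinct $i,j,k\in[n]$, with $r=r(i,j,k)$, $s=s(i,j,k)$, the two clauses $T_{i,j,k}\lor x_{r,s}$ and $T_{i,j,k}\lor\overline x_{r,s}$. Resolution: from $A'\lor x$ and $B'\lor\overline x$ (with $\overline x\notin A'\lor x$, $x\notin B'\lor\overline x$) infer $A'\lor B'$. For a binary tree $T$, the postorder $<_T$ is defined by: if $v$ is in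 the subtree of the left child of $u$ and $w$ in the subtree of the right child of $u$, then $v<_T w<_T u$. A tree-like regular resolution proof with lemmas from a clause set $F$ is a binary tree $T$ in which each internal node is labeled with a clause obtained by resolution on a specified variable from the clauses at its two children, each leaf is labeled either with a clause of $F$ or with a clause (a "lemma") labeling some node earlier in the $<_T$ order, and along every root-to-leaf path each variable is resolved on at most once. It uses only input lemmas if every lemma used at a leaf labels an earlier node whose subderivation is an input derivation, i.e. one in which every inference has at least one hypothesis that is a clause of $F$ or a lemma. A refutation is such a proof whose root is labeled $\Box$; size is the number of clauses. *)

theory Defs
  imports Complex_Main "HOL-Computational_Algebra.Polynomial"
begin

section \<open>Clauses and resolution\<close>

datatype 'v literal = Pos 'v | Neg 'v

fun negate :: "'v literal \<Rightarrow> 'v literal" where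
  "negate (Pos v) = Neg v"
| "negate (Neg v) = Pos v"

type_synonym 'v clause = "'v literal set"

definition resolvent :: "'v \<Rightarrow> 'v clause \<Rightarrow> 'v clause \<Rightarrow> 'v clause \<Rightarrow> bool" where
  "resolvent v A B C \<longleftrightarrow>
     Pos v \<in> A \<and> Neg v \<notin> A \<and> Neg v \<in> B \<and> Pos v \<notin> B \<and>
     C = (A - {Pos v}) \<union> (B - {Neg v})"

section \<open>Tree-like regular resolution with input lemmas\<close>

text \<open>
  An ordered binary tree of clauses; an internal node also records the variable resolved on.
\<close>

datatype 'v rtree =
    Leaf "'v clause"
  | Infer 'v "'v clause" "'v rtree" "'v rtree"

fun concl :: "'v rtree \<Rightarrow> 'v clause" where
  "concl (Leaf C) = C"
| "concl (Infer v C l r) = C"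

fun is_leaf :: "'v rtree \<Rightarrow> bool" where
  "is_leaf (Leaf C) = True"
| "is_leaf (Infer v C l r) = False"

text \<open>
  A node is represented by its position in the postorder list, whose entry is the subtree
  rooted at that node; comparing positions is the order \<open><\<^sub>T\<close>. Distinct nodes have
  distinct positions even if their subtrees are equal.
\<close>

fun nodes :: "'v rtree \<Rightarrow> 'v rtree list" where
  "nodes (Leaf C) = [Leaf C]"
| "nodes (Infer v C l r) = nodes l @ nodes r @ [Infer v C l r]"

definition num_clauses :: "'v rtree \<Rightarrow> nat" where
  "num_clauses T = length (nodes T)"

text \<open>
  Either child may be the one that contains the variable positively, so the left-to-right
  order of the children is independent of the polarity.
\<close>

fun valid_inferences :: "'v rtree \<Rightarrow> bool" where
  "valid_inferences (Leaf C) \<longleftrightarrow> True"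
| "valid_inferences (Infer v C l r) \<longleftrightarrow>
     (resolvent v (concl l) (concl r) C \<or> resolvent v (concl r) (concl l) C) \<and>
     valid_inferences l \<and> valid_inferences r"

text \<open>
  Leaves carry clauses of the initial set or lemmas, so a hypothesis that is an initial
  clause or a lemma is a child that is a leaf.
\<close>

fun input_derivation :: "'v rtree \<Rightarrow> bool" where
  "input_derivation (Leaf C) \<longleftrightarrow> True"
| "input_derivation (Infer v C l r) \<longleftrightarrow>
     (is_leaf l \<or> is_leaf r) \<and> input_derivation l \<and> input_derivation r"

definition leaves_initial_or_input_lemmas :: "'v clause set \<Rightarrow> 'v rtree \<Rightarrow> bool" where
  "leaves_initial_or_input_lemmas F T \<longleftrightarrow>
     (\<forall>i C. i < length (nodes T) \<and> nodes T ! i = Leaf C \<longrightarrow>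
        C \<in> F \<or>
        (\<exists>j<i. concl (nodes T ! j) = C \<and> input_derivation (nodes T ! j)))"

text \<open>For every root-to-leaf path, the list of variables resolved on along it.\<close>

fun paths :: "'v rtree \<Rightarrow> 'v list set" where
  "paths (Leaf C) = {[]}"
| "paths (Infer v C l r) = (\<lambda>vs. v # vs) ` (paths l \<union> paths r)"

definition regular :: "'v rtree \<Rightarrow> bool" where
  "regular T \<longleftrightarrow> (\<forall>vs\<in>paths T. distinct vs)"

definition regRTI_proof :: "'v clause set \<Rightarrow> 'v rtree \<Rightarrow> bool" where
  "regRTI_proof F T \<longleftrightarrow>
     valid_inferences T \<and> leaves_initial_or_input_lemmas F T \<and> regular T"

definition regRTI_refutation :: "'v clause set \<Rightarrow> 'v rtree \<Rightarrow> bool" where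
  "regRTI_refutation F T \<longleftrightarrow> regRTI_proof F T \<and> concl T = {}"

section \<open>Guarded graph tautologies\<close>

text \<open>
  The literal \<open>xlit i j\<close> is only meant for \<open>i \<noteq> j\<close>. Identifying \<open>xlit i j\<close> with the negation of
  \<open>xlit j i\<close> leaves one variable for each pair \<open>(i, j)\<close> with \<open>i < j\<close>.
\<close>

definition xlit :: "nat \<Rightarrow> nat \<Rightarrow> (nat \<times> nat) literal" where
  "xlit i j = (if i < j then Pos (i, j) else Neg (j, i))"

lemma negate_xlit: "i \<noteq> j \<Longrightarrow> negate (xlit i j) = xlit j i"
  by (auto simp: xlit_def)

definition T_clause :: "nat \<Rightarrow> nat \<Rightarrow> nat \<Rightarrow> (nat \<times> nat) clause" where
  "T_clause i j k = {negate (xlit i j), negate (xlit j k), negate (xlit k i)}"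

definition distinct_triple :: "nat \<Rightarrow> nat \<Rightarrow> nat \<Rightarrow> nat \<Rightarrow> bool" where
  "distinct_triple n i j k \<longleftrightarrow> i < n \<and> j < n \<and> k < n \<and> i \<noteq> j \<and> j \<noteq> k \<and> i \<noteq> k"

definition guards :: "nat \<Rightarrow> (nat \<Rightarrow> nat \<Rightarrow> nat \<Rightarrow> nat) \<Rightarrow> (nat \<Rightarrow> nat \<Rightarrow> nat \<Rightarrow> nat) \<Rightarrow> bool" where
  "guards n r s \<longleftrightarrow>
     (\<forall>i<n. \<forall>j<n. \<forall>k<n. r i j k < n \<and> s i j k < n) \<and>
     (\<forall>i j k. distinct_triple n i j k \<longrightarrow>
        r i j k \<noteq> s i j k \<and>
        \<not> {r i j k, s i j k} \<subseteq> {i, j, k} \<and>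
        r i j k = r j k i \<and> r j k i = r k i j \<and>
        s i j k = s j k i \<and> s j k i = s k i j)"

definition GGT ::
  "nat \<Rightarrow> (nat \<Rightarrow> nat \<Rightarrow> nat \<Rightarrow> nat) \<Rightarrow> (nat \<Rightarrow> nat \<Rightarrow> nat \<Rightarrow> nat) \<Rightarrow> (nat \<times> nat) clause set" where
  "GGT n r s =
     {{xlit j i | j. j < n \<and> j \<noteq> i} | i. i < n} \<union>
     {T_clause i j k \<union> {xlit (r i j k) (s i j k)} | i j k. distinct_triple n i j k} \<union>
     {T_clause i j k \<union> {negate (xlit (r i j k) (s i j k))} | i j k. distinct_triple n i j k}"

end

theory Submission
  imports Defs
begin

text \<open>
  Reading \<open>x\<^sub>i\<^sub>,\<^sub>j\<close> as an edge from \<open>i\<close> to \<open>j\<close>, a branch of the refutation is a set \<open>E\<close> of edges.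
  If the guard of \<open>T\<^sub>i\<^sub>,\<^sub>j\<^sub>,\<^sub>k\<close> is already set in the branch, an initial clause serves in its
  place; otherwise \<open>T\<^sub>i\<^sub>,\<^sub>j\<^sub>,\<^sub>k\<close> can be derived by resolving on the guard, and is then a lemma for
  the remainder of the refutation. Either all \<open>T\<^sub>i\<^sub>,\<^sub>j\<^sub>,\<^sub>k\<close> needed for the usual elimination
  refutation on the sources of \<open>E\<close> are available, and that refutation closes the branch, or one
  is missing. In the latter case one branches on its variables, learns it where it is falsified
  and continues in at most three other branches. At most \<open>n\<^sup>3\<close> such clauses can be learned, so
  there are only polynomially many branches.

  There is no weakening, so the literals branched on must be shown to occur in the derived
  clauses. This is guaranteed for the edges of \<open>E\<close> that leave a source; ensuring that each
  non-source has an edge from a source makes it possible to branch on such edges only.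
\<close>

section \<open>Local criteria for regularity and for the use of input lemmas\<close>

fun ivars :: "'v rtree \<Rightarrow> 'v set" where
  "ivars (Leaf C) = {}"
| "ivars (Infer v C l r) = insert v (ivars l \<union> ivars r)"

fun read_once :: "'v rtree \<Rightarrow> bool" where
  "read_once (Leaf C) \<longleftrightarrow> True"
| "read_once (Infer v C l r) \<longleftrightarrow> v \<notin> ivars l \<union> ivars r \<and> read_once l \<and> read_once r"

definition learned :: "'v rtree \<Rightarrow> 'v clause set" where
  "learned P = concl ` {N \<in> set (nodes P). input_derivation N}"

text \<open>The postorder condition on lemmas in recursive form. The set \<open>L\<close> holds
  initial clauses together with lemmas learned outside the tree, so that pieces of a refutation can
  be built separately.\<close>

fun leaves_from :: "'v clause set \<Rightarrow> 'v rtree \<Rightarrow> bool" where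
  "leaves_from L (Leaf C) \<longleftrightarrow> C \<in> L"
| "leaves_from L (Infer v C l r) \<longleftrightarrow> leaves_from L l \<and> leaves_from (L \<union> learned l) r"

lemma learned_Leaf [simp]: "learned (Leaf C) = {C}"
  by (auto simp: learned_def)

lemma learned_Infer [simp]:
  "learned (Infer v C l r) =
     learned l \<union> learned r \<union> (if input_derivation (Infer v C l r) then {C} else {})"
proof -
  have "{N \<in> set (nodes (Infer v C l r)). input_derivation N} =
      {N \<in> set (nodes l). input_derivation N} \<union> {N \<in> set (nodes r). input_derivation N} \<union>
      (if input_derivation (Infer v C l r) then {Infer v C l r} else {})"
    by (auto simp del: input_derivation.simps)
  then show ?thesis by (simp add: learned_def image_Un del: nodes.simps input_derivation.simps)
qed

lemma input_concl_learned: "input_derivation P \<Longrightarrow> concl P \<in> learned P"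
  by (cases P) auto

lemma num_clauses_simps [simp]:
  "num_clauses (Leaf C) = 1"
  "num_clauses (Infer v C l r) = num_clauses l + num_clauses r + 1"
  by (auto simp: num_clauses_def)

lemma paths_ivars: "vs \<in> paths P \<Longrightarrow> set vs \<subseteq> ivars P"
proof (induction P arbitrary: vs)
  case (Infer v C l r)
  then obtain ws where "vs = v # ws" "ws \<in> paths l \<or> ws \<in> paths r" by auto
  then show ?case using Infer.IH[of ws] by auto
qed auto

lemma read_once_regular: "read_once P \<Longrightarrow> regular P"
proof (induction P)
  case (Infer v C l r)
  then have IH: "regular l" "regular r" and v: "v \<notin> ivars l" "v \<notin> ivars r" by auto
  have "v \<notin> set vs" if "vs \<in> paths l \<union> paths r" for vs
    using that v paths_ivars by blast
  with IH show ?case by (auto simp: regular_def)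
qed (auto simp: regular_def)

text \<open>In the postorder list the nodes of \<open>r\<close> are shifted by the length of
  \<open>nodes l\<close>, so every clause of \<open>learned l\<close> stands before every leaf of
  \<open>r\<close>.\<close>

lemma leaves_from_nth:
  assumes "leaves_from L P" "i < length (nodes P)" "nodes P ! i = Leaf C"
  shows "C \<in> L \<or> (\<exists>j<i. concl (nodes P ! j) = C \<and> input_derivation (nodes P ! j))"
  using assms
proof (induction P arbitrary: L i)
  case (Leaf D)
  then show ?case by auto
next
  case (Infer v D l r)
  let ?a = "length (nodes l)" and ?b = "length (nodes r)"
  consider "i < ?a" | "?a \<le> i" "i < ?a + ?b" | "i = ?a + ?b"
    using Infer.prems(2) by fastforce
  then show ?case
  proof cases
    case 1
    then have "nodes l ! i = Leaf C"
      using Infer.prems(3) by (simp add: nth_append)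
    from Infer.IH(1)[OF _ 1 this] Infer.prems(1)
    have "C \<in> L \<or> (\<exists>j<i. concl (nodes l ! j) = C \<and> input_derivation (nodes l ! j))"
      by auto
    moreover have "nodes (Infer v D l r) ! j = nodes l ! j" if "j < i" for j
      using that 1 by (simp add: nth_append)
    ultimately show ?thesis by metis
  next
    case 2
    define k where "k = i - ?a"
    have i: "i = ?a + k" "k < ?b" using 2 by (auto simp: k_def)
    have eq: "nodes (Infer v D l r) ! (?a + j) = nodes r ! j" if "j < ?b" for j
      using that by (simp add: nth_append)
    have "nodes r ! k = Leaf C" using Infer.prems(3) eq[OF i(2)] i(1) by simp
    from Infer.IH(2)[OF _ i(2) this, of "L \<union> learned l"] Infer.prems(1)
    consider "C \<in> L" | "C \<in> learned l"
      | j where "j < k" "concl (nodes r ! j) = C" "input_derivation (nodes r ! j)"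
      by auto
    then show ?thesis
    proof cases
      case 2
      then obtain N where N: "N \<in> set (nodes l)" "input_derivation N" "concl N = C"
        by (auto simp: learned_def)
      then obtain j where "j < ?a" "nodes l ! j = N" by (auto simp: in_set_conv_nth)
      with N i show ?thesis by (intro disjI2 exI[of _ j]) (auto simp: nth_append)
    next
      case 3
      with i eq[of j] show ?thesis by (intro disjI2 exI[of _ "?a + j"]) auto
    qed auto
  next
    case 3
    with Infer.prems(3) show ?thesis by (simp add: nth_append)
  qed
qed

lemma regRTI_refutationI:
  assumes "valid_inferences P" "leaves_from F P" "read_once P" "concl P = {}"
  shows "regRTI_refutation F P"
  using assms leaves_from_nth[OF assms(2)] read_once_regular
  by (auto simp: regRTI_refutation_def regRTI_proof_def leaves_initial_or_input_lemmas_def)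

section \<open>Partial assignments as edge sets, and derivations under them\<close>

definition xvar :: "nat \<Rightarrow> nat \<Rightarrow> nat \<times> nat" where
  "xvar i j = (if i < j then (i, j) else (j, i))"

lemma xlit_eq_iff [simp]: "xlit i j = xlit k l \<longleftrightarrow> i = k \<and> j = l"
  by (auto simp: xlit_def)

lemma xvar_eq_iff [simp]: "xvar i j = xvar k l \<longleftrightarrow> i = k \<and> j = l \<or> i = l \<and> j = k"
  by (auto simp: xvar_def)

lemma xvar_commute: "xvar i j = xvar j i"
  by simp

lemma T_clause_eq:
  "i \<noteq> j \<Longrightarrow> j \<noteq> k \<Longrightarrow> i \<noteq> k \<Longrightarrow> T_clause i j k = {xlit j i, xlit k j, xlit i k}"
  by (simp add: T_clause_def negate_xlit)

text \<open>
  A set of edges \<open>E\<close> encodes the partial assignment in which \<open>x\<^sub>i\<^sub>,\<^sub>j\<close> is true for \<open>(i, j) \<in> E\<close>;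
  \<open>negs E\<close> is the clause it falsifies.
\<close>

definition negs :: "(nat \<times> nat) set \<Rightarrow> (nat \<times> nat) clause" where
  "negs E = (\<lambda>(i, j). xlit j i) ` E"

definition edge_vars :: "(nat \<times> nat) set \<Rightarrow> (nat \<times> nat) set" where
  "edge_vars E = (\<lambda>(i, j). xvar i j) ` E"

lemma xlit_in_negs [simp]: "xlit j i \<in> negs E \<longleftrightarrow> (i, j) \<in> E"
  by (auto simp: negs_def)

lemma negs_insert [simp]: "negs (insert (i, j) E) = insert (xlit j i) (negs E)"
  by (auto simp: negs_def)

lemma xvar_in_edge_vars [simp]: "xvar i j \<in> edge_vars E \<longleftrightarrow> (i, j) \<in> E \<or> (j, i) \<in> E"
  by (force simp: edge_vars_def)

lemma edge_vars_insert [simp]: "edge_vars (insert (i, j) E) = insert (xvar i j) (edge_vars E)"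
  by (auto simp: edge_vars_def)

text \<open>
  The two-sided condition on the conclusion replaces weakening, which is not available: the
  conclusion may pick up literals falsified by the assignment \<open>E\<close> of the current branch, but
  it is guaranteed to contain \<open>X\<close>, so that the inferences below remain possible.
\<close>

definition derives ::
  "(nat \<times> nat) clause set \<Rightarrow> (nat \<times> nat) set \<Rightarrow> (nat \<times> nat) set \<Rightarrow> (nat \<times> nat) clause \<Rightarrow>
   (nat \<times> nat) rtree \<Rightarrow> bool" where
  "derives L E U X P \<longleftrightarrow>
     valid_inferences P \<and> leaves_from L P \<and> read_once P \<and> ivars P \<inter> U = {} \<and>
     X \<subseteq> concl P \<and> concl P \<subseteq> X \<union> negs E"

definition avail :: "(nat \<times> nat) clause set \<Rightarrow> (nat \<times> nat) set \<Rightarrow> (nat \<times> nat) clause \<Rightarrow> bool" where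
  "avail L E X \<longleftrightarrow> (\<exists>C\<in>L. X \<subseteq> C \<and> C \<subseteq> X \<union> negs E)"

text \<open>\<open>P\<close> becomes the left child, so its lemmas may be used in \<open>Q\<close>.
  Which premise is the positive one depends on whether \<open>a < b\<close> and is left
  open.\<close>

definition resolve ::
  "nat \<Rightarrow> nat \<Rightarrow> (nat \<times> nat) rtree \<Rightarrow> (nat \<times> nat) rtree \<Rightarrow> (nat \<times> nat) rtree" where
  "resolve a b P Q =
     Infer (xvar a b) ((concl P - {xlit a b}) \<union> (concl Q - {xlit b a})) P Q"

lemma resolve_simps [simp]:
  "num_clauses (resolve a b P Q) = num_clauses P + num_clauses Q + 1"
  "is_leaf (resolve a b P Q) \<longleftrightarrow> False"
  "input_derivation (resolve a b P Q) \<longleftrightarrow>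
     (is_leaf P \<or> is_leaf Q) \<and> input_derivation P \<and> input_derivation Q"
  "ivars (resolve a b P Q) = insert (xvar a b) (ivars P \<union> ivars Q)"
  "concl (resolve a b P Q) = (concl P - {xlit a b}) \<union> (concl Q - {xlit b a})"
  by (auto simp: resolve_def)

lemma learned_resolve: "learned P \<union> learned Q \<subseteq> learned (resolve a b P Q)"
  by (auto simp: resolve_def)

text \<open>\<open>U\<close> carries regularity: it collects variables kept for inferences nearer
  the root, and the pivot joins it in both premises. As neither orientation of the pivot is in
  \<open>E\<close>, side literals from \<open>negs E\<close> cannot bring in its complement.\<close>

lemma derives_resolve:
  assumes P: "derives L E (insert (xvar a b) U) X P"
    and Q: "derives (L \<union> learned P) E (insert (xvar a b) U) Y Q"
    and ab: "a \<noteq> b" "xvar a b \<notin> U" "(a, b) \<notin> E" "(b, a) \<notin> E"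
    and lits: "xlit a b \<in> X" "xlit b a \<notin> X" "xlit b a \<in> Y" "xlit a b \<notin> Y"
  shows "derives L E U ((X - {xlit a b}) \<union> (Y - {xlit b a})) (resolve a b P Q)"
proof -
  have "xlit a b \<in> concl P" "xlit b a \<notin> concl P" "xlit b a \<in> concl Q" "xlit a b \<notin> concl Q"
    using assms by (auto simp: derives_def)
  with ab(1) have "resolvent (xvar a b) (concl P) (concl Q) (concl (resolve a b P Q)) \<or>
      resolvent (xvar a b) (concl Q) (concl P) (concl (resolve a b P Q))"
    by (auto simp: resolvent_def xlit_def xvar_def split: if_splits)
  then have "valid_inferences (resolve a b P Q)"
    using P Q by (auto simp: resolve_def derives_def)
  moreover have "leaves_from L (resolve a b P Q)" "read_once (resolve a b P Q)"
    using P Q by (auto simp: resolve_def derives_def)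
  ultimately show ?thesis
    using P Q ab(2) unfolding derives_def by auto
qed

lemma derives_Leaf:
  "C \<in> L \<Longrightarrow> X \<subseteq> C \<Longrightarrow> C \<subseteq> X \<union> negs E \<Longrightarrow> derives L E U X (Leaf C)"
  by (auto simp: derives_def)

lemma avail_derives:
  assumes "avail L E X"
  obtains C where "derives L E U X (Leaf C)"
  using assms derives_Leaf unfolding avail_def by blast

lemma derives_cong:
  "derives L E U X P \<Longrightarrow> Y \<subseteq> X \<Longrightarrow> X \<subseteq> Y \<union> negs E \<Longrightarrow> V \<subseteq> U \<Longrightarrow> derives L E V Y P"
  unfolding derives_def by blast

text \<open>The way back from a branch to its parent: a side literal guaranteed to occur anyway need
  not be excused by the branch edge. Resolving on that edge then removes it.\<close>

lemma derives_drop_edge: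
  "derives L (insert (i, j) E) U X P \<Longrightarrow> xlit j i \<in> X \<Longrightarrow> derives L E U X P"
  by (auto simp: derives_def)

lemma derives_add_edge:
  "derives L E U X P \<Longrightarrow> derives L (insert (i, j) E) U X P"
  by (auto simp: derives_def)

lemma derives_input_avail:
  "derives L E U X P \<Longrightarrow> input_derivation P \<Longrightarrow> avail (L \<union> learned P) E X"
  using input_concl_learned unfolding derives_def avail_def by blast

lemma avail_mono: "avail L E X \<Longrightarrow> L \<subseteq> L' \<Longrightarrow> avail L' E X"
  by (auto simp: avail_def)

lemma insert_Diff_insert_eq: "x \<in> A \<Longrightarrow> x \<notin> B \<Longrightarrow> insert x (A - insert x B) = A - B"
  by blast

text \<open>A linear derivation that resolves the clause of \<open>P\<close> with one leaf per
  \<open>j\<close>. No side clause contains a pivot literal of \<open>X\<close> or the complement of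
  another pivot, so the steps do not interfere and their order is irrelevant. All side premises
  being leaves, an input derivation stays one; each step adds a leaf and an inference.\<close>

lemma derives_chain:
  assumes "finite J"
    and P: "derives L E U X P"
    and U: "(\<lambda>j. xvar (a j) (b j)) ` J \<subseteq> U"
    and av: "\<And>j. j \<in> J \<Longrightarrow> avail L E (Y j)"
    and ab: "\<And>j. j \<in> J \<Longrightarrow> a j \<noteq> b j \<and> (a j, b j) \<notin> E \<and> (b j, a j) \<notin> E"
    and inj: "\<And>j k. j \<in> J \<Longrightarrow> k \<in> J \<Longrightarrow> xvar (a j) (b j) = xvar (a k) (b k) \<Longrightarrow> j = k"
    and X: "\<And>j. j \<in> J \<Longrightarrow> xlit (a j) (b j) \<in> X \<and> xlit (b j) (a j) \<notin> X"
    and Y: "\<And>j. j \<in> J \<Longrightarrow> xlit (b j) (a j) \<in> Y j"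
    and Y': "\<And>j k. j \<in> J \<Longrightarrow> k \<in> J \<Longrightarrow> xlit (a k) (b k) \<notin> Y j"
    and Y'': "\<And>j k. j \<in> J \<Longrightarrow> k \<in> J \<Longrightarrow> xlit (b k) (a k) \<in> Y j \<Longrightarrow> j = k"
  shows "\<exists>Q. derives L E (U - (\<lambda>j. xvar (a j) (b j)) ` J)
              ((X - (\<lambda>j. xlit (a j) (b j)) ` J) \<union> (\<Union>j\<in>J. Y j - {xlit (b j) (a j)})) Q \<and>
             num_clauses Q = num_clauses P + 2 * card J \<and>
             (input_derivation P \<longrightarrow> input_derivation Q) \<and> learned P \<subseteq> learned Q"
  using assms
proof (induction J rule: finite_induct)
  case empty
  then show ?case by auto
next
  case (insert j J)
  let ?v = "\<lambda>j. xvar (a j) (b j)" and ?l = "\<lambda>j. xlit (a j) (b j)"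
  have "\<exists>Q. derives L E (U - ?v ` J)
        ((X - ?l ` J) \<union> (\<Union>j\<in>J. Y j - {xlit (b j) (a j)})) Q \<and>
      num_clauses Q = num_clauses P + 2 * card J \<and>
      (input_derivation P \<longrightarrow> input_derivation Q) \<and> learned P \<subseteq> learned Q"
    by (rule insert.IH; (rule insert.prems)?) (use insert.prems(2) in auto)
  then obtain Q where Q: "derives L E (U - ?v ` J)
        ((X - ?l ` J) \<union> (\<Union>j\<in>J. Y j - {xlit (b j) (a j)})) Q"
      "num_clauses Q = num_clauses P + 2 * card J"
      "input_derivation P \<longrightarrow> input_derivation Q" "learned P \<subseteq> learned Q"
    by blast
  obtain C where C: "derives (L \<union> learned Q) E (U - ?v ` J) (Y j) (Leaf C)"
    using avail_derives[OF avail_mono[OF insert.prems(3)[OF insertI1] Un_upper1]] .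
  let ?U = "U - ?v ` insert j J"
  have nin: "?v j \<notin> ?v ` J" using insert.prems(5) insert.hyps(2) by blast
  then have U: "insert (?v j) ?U = U - ?v ` J"
    using insert.prems(2) insert_Diff_insert_eq[of "?v j" U "?v ` J"] by simp
  have l: "?l j \<notin> ?l ` J"
    using nin by auto
  have "derives L E ?U ((((X - ?l ` J) \<union> (\<Union>j\<in>J. Y j - {xlit (b j) (a j)})) - {?l j}) \<union>
      (Y j - {xlit (b j) (a j)})) (resolve (a j) (b j) Q (Leaf C))"
  proof (rule derives_resolve)
    show "?l j \<in> X - ?l ` J \<union> (\<Union>j\<in>J. Y j - {xlit (b j) (a j)})"
      using insert.prems(6)[of j] l by auto
    show "xlit (b j) (a j) \<notin> X - ?l ` J \<union> (\<Union>j\<in>J. Y j - {xlit (b j) (a j)})"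
      using insert.prems(6)[of j] insert.prems(9)[of _ j] insert.hyps(2) by auto
    show "derives L E (insert (?v j) ?U)
        (X - ?l ` J \<union> (\<Union>j\<in>J. Y j - {xlit (b j) (a j)})) Q"
      unfolding U by (rule Q(1))
    show "derives (L \<union> learned Q) E (insert (?v j) ?U) (Y j) (Leaf C)"
      unfolding U by (rule C)
  qed (use insert.prems(4,7,8)[of j] in auto)
  moreover have "((X - ?l ` J) \<union> (\<Union>j\<in>J. Y j - {xlit (b j) (a j)})) - {?l j} =
      (X - ?l ` insert j J) \<union> (\<Union>j\<in>J. Y j - {xlit (b j) (a j)})"
    using insert.prems(8)[of _ j] by blast
  ultimately have "derives L E ?U ((X - ?l ` insert j J) \<union>
      (\<Union>j\<in>insert j J. Y j - {xlit (b j) (a j)})) (resolve (a j) (b j) Q (Leaf C))"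
    by (simp add: Un_ac)
  moreover have "learned P \<subseteq> learned (resolve (a j) (b j) Q (Leaf C))"
    using Q(4) learned_resolve by blast
  ultimately show ?case
    using Q insert.hyps by (intro exI[of _ "resolve (a j) (b j) Q (Leaf C)"]) auto
qed

section \<open>Sources of the assignment and measures of progress\<close>

definition roots :: "nat \<Rightarrow> (nat \<times> nat) set \<Rightarrow> nat set" where
  "roots n E = {i. i < n \<and> (\<forall>j. (j, i) \<notin> E)}"

definition root_clause :: "nat \<Rightarrow> (nat \<times> nat) set \<Rightarrow> (nat \<times> nat) clause" where
  "root_clause n E = negs {(i, j) \<in> E. i \<in> roots n E}"

lemma xlit_in_root_clause [simp]:
  "xlit j i \<in> root_clause n E \<longleftrightarrow> (i, j) \<in> E \<and> i \<in> roots n E"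
  by (auto simp: root_clause_def)

lemma root_clause_negs: "root_clause n E \<subseteq> negs E"
  by (auto simp: root_clause_def negs_def)

definition oriented :: "nat \<Rightarrow> (nat \<times> nat) set \<Rightarrow> bool" where
  "oriented n E \<longleftrightarrow> E \<subseteq> {..<n} \<times> {..<n} \<and> (\<forall>i j. (i, j) \<in> E \<longrightarrow> (j, i) \<notin> E)"

definition covered :: "nat \<Rightarrow> (nat \<times> nat) set \<Rightarrow> bool" where
  "covered n E \<longleftrightarrow> (\<forall>l<n. l \<notin> roots n E \<longrightarrow> (\<exists>p\<in>roots n E. (p, l) \<in> E))"

text \<open>The invariant that survives branching: when a source \<open>p\<close> receives an edge
  from a source \<open>a\<close>, the vertices covered by \<open>p\<close> are two steps away from
  \<open>a\<close>. Adding shortcut edges later restores \<open>covered\<close>.\<close>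

definition weakly_covered :: "nat \<Rightarrow> (nat \<times> nat) set \<Rightarrow> bool" where
  "weakly_covered n E \<longleftrightarrow>
     (\<forall>l<n. l \<notin> roots n E \<longrightarrow>
        (\<exists>p\<in>roots n E. (p, l) \<in> E \<or> (\<exists>j. (p, j) \<in> E \<and> (j, l) \<in> E)))"

lemma oriented_insert:
  "oriented n E \<Longrightarrow> a < n \<Longrightarrow> b < n \<Longrightarrow> a \<noteq> b \<Longrightarrow> (b, a) \<notin> E \<Longrightarrow> oriented n (insert (a, b) E)"
  by (auto simp: oriented_def)

text \<open>
  The roots are eliminated in decreasing order; the clause of an eliminated root \<open>l \<ge> m\<close> has
  contributed the literals of the edges leaving \<open>l\<close>.
\<close>

definition elim_clause :: "nat \<Rightarrow> (nat \<times> nat) set \<Rightarrow> nat \<Rightarrow> nat \<Rightarrow> (nat \<times> nat) clause" where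
  "elim_clause n E m i =
     {xlit j i | j. j \<in> roots n E \<and> j < m \<and> j \<noteq> i} \<union>
     negs {(l, j) \<in> E. l \<in> roots n E \<and> (l = i \<or> l \<ge> m)}"

lemma xlit_in_elim_clause [simp]:
  "xlit j l \<in> elim_clause n E m i \<longleftrightarrow>
     l = i \<and> j \<in> roots n E \<and> j < m \<and> j \<noteq> i \<or>
     (l, j) \<in> E \<and> l \<in> roots n E \<and> (l = i \<or> l \<ge> m)"
  by (auto simp: elim_clause_def)

text \<open>The potential for the elimination under one fixed \<open>E\<close>; side literals from
  \<open>negs E\<close> are harmless there.\<close>

definition unelim :: "nat \<Rightarrow> (nat \<times> nat) set \<Rightarrow> (nat \<times> nat) clause set \<Rightarrow> nat" where
  "unelim n E L =
     card {(m, i). m \<le> n \<and> i < m \<and> i \<in> roots n E \<and> \<not> avail L E (elim_clause n E m i)}"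

lemma finite_unelim: "finite {(m, i). m \<le> n \<and> i < m \<and> P (m::nat) (i::nat)}"
  by (rule finite_subset[of _ "{..n} \<times> {..n}"]) auto

lemma unelim_mono: "L \<subseteq> L' \<Longrightarrow> unelim n E L' \<le> unelim n E L"
  unfolding unelim_def
  by (intro card_mono finite_unelim) (auto dest: avail_mono)

lemma unelim_less:
  assumes "L \<subseteq> L'" "m \<le> n" "i < m" "i \<in> roots n E"
    "\<not> avail L E (elim_clause n E m i)" "avail L' E (elim_clause n E m i)"
  shows "unelim n E L' < unelim n E L"
  unfolding unelim_def
proof (rule psubset_card_mono[OF finite_unelim], rule psubsetI)
  show "{(m, i). m \<le> n \<and> i < m \<and> i \<in> roots n E \<and> \<not> avail L' E (elim_clause n E m i)} \<noteq>
      {(m, i). m \<le> n \<and> i < m \<and> i \<in> roots n E \<and> \<not> avail L E (elim_clause n E m i)}"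
    using assms(2-) by blast
qed (use assms(1) in \<open>auto dest: avail_mono\<close>)

lemma unelim_le: "unelim n E L \<le> (n + 1) * (n + 1)"
proof -
  have "unelim n E L \<le> card ({..n} \<times> {..n})"
    unfolding unelim_def by (rule card_mono) auto
  then show ?thesis by simp
qed

text \<open>The potential for the whole refutation. Membership replaces \<open>avail\<close> because
  the count has to keep its meaning when \<open>E\<close> changes from branch to branch.\<close>

definition unlearned :: "nat \<Rightarrow> (nat \<times> nat) clause set \<Rightarrow> nat" where
  "unlearned n L = card {(i, j, k). distinct_triple n i j k \<and> T_clause i j k \<notin> L}"

lemma finite_triples: "finite {(i, j, k). distinct_triple n i j k \<and> P i j k}"
  by (rule finite_subset[of _ "{..<n} \<times> {..<n} \<times> {..<n}"]) (auto simp: distinct_triple_def)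

lemma unlearned_mono: "L \<subseteq> L' \<Longrightarrow> unlearned n L' \<le> unlearned n L"
  unfolding unlearned_def
  by (intro card_mono finite_triples) auto

lemma unlearned_less:
  assumes "L \<subseteq> L'" "distinct_triple n i j k" "T_clause i j k \<notin> L" "T_clause i j k \<in> L'"
  shows "unlearned n L' < unlearned n L"
  unfolding unlearned_def
proof (rule psubset_card_mono[OF finite_triples], rule psubsetI)
  show "{(i, j, k). distinct_triple n i j k \<and> T_clause i j k \<notin> L'} \<noteq>
      {(i, j, k). distinct_triple n i j k \<and> T_clause i j k \<notin> L}"
    using assms(2-) by blast
qed (use assms(1) in auto)

lemma unlearned_le: "unlearned n L \<le> n * (n * n)"
proof -
  have "unlearned n L \<le> card ({..<n} \<times> {..<n} \<times> {..<n})"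
    unfolding unlearned_def by (rule card_mono) (auto simp: distinct_triple_def)
  then show ?thesis by (simp add: card_cartesian_product)
qed

section \<open>Removing the guards\<close>

locale guarded =
  fixes n :: nat and r s :: "nat \<Rightarrow> nat \<Rightarrow> nat \<Rightarrow> nat"
  assumes guards: "guards n r s" and n: "n > 1"
begin

text \<open>If \<open>E\<close> sets the guard, one of the two initial clauses differs from
  \<open>T_clause i j k\<close> by a falsified literal. Otherwise one resolution on the guard gives
  it exactly, with 3 nodes. The guard condition separates the guard variable from the three
  variables of the clause, so \<open>U\<close> permits that pivot.\<close>

lemma T_derivable:
  assumes ijk: "distinct_triple n i j k" and F: "GGT n r s \<subseteq> L"
    and U: "U \<subseteq> edge_vars E \<union> {xvar i j, xvar j k, xvar k i}"
  obtains P where "derives L E U (T_clause i j k) P" "num_clauses P \<le> 3"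
    "avail L E (T_clause i j k) \<or> T_clause i j k \<in> learned P"
proof (cases "avail L E (T_clause i j k)")
  case True
  then show ?thesis using avail_derives[OF True] that by (metis num_clauses_simps(1) one_le_numeral)
next
  case False
  define a b where "a = r i j k" and "b = s i j k"
  let ?T = "T_clause i j k"
  have ab: "a \<noteq> b" "\<not> {a, b} \<subseteq> {i, j, k}"
    using guards ijk unfolding guards_def a_def b_def by blast+
  have T: "?T = {xlit j i, xlit k j, xlit i k}"
    using ijk by (auto simp: distinct_triple_def T_clause_eq)
  have "?T \<union> {xlit a b} \<in> GGT n r s" "?T \<union> {negate (xlit a b)} \<in> GGT n r s"
    using ijk unfolding GGT_def a_def b_def by blast+
  then have GGT: "insert (xlit a b) ?T \<in> L" "insert (xlit b a) ?T \<in> L"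
    using F ab(1) by (auto simp: negate_xlit)
  have "avail L E ?T" if "(x, y) \<in> E" "insert (xlit y x) ?T \<in> L" for x y
    unfolding avail_def by (rule bexI[OF _ that(2)]) (use that(1) in auto)
  with False GGT have nE: "(a, b) \<notin> E" "(b, a) \<notin> E" by blast+
  have nT: "xlit a b \<notin> ?T" "xlit b a \<notin> ?T" "xvar a b \<notin> U"
    using ab U nE by (auto simp: T)
  define P where "P = resolve a b (Leaf (insert (xlit a b) ?T)) (Leaf (insert (xlit b a) ?T))"
  have "derives L E U (insert (xlit a b) ?T - {xlit a b} \<union> (insert (xlit b a) ?T - {xlit b a})) P"
    unfolding P_def
    by (rule derives_resolve) (use GGT ab nE nT in \<open>auto intro!: derives_Leaf\<close>)
  moreover have eq: "insert (xlit a b) ?T - {xlit a b} \<union> (insert (xlit b a) ?T - {xlit b a}) = ?T"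
    using nT by auto
  moreover have "?T \<in> learned P"
    using input_concl_learned[of P] eq by (simp add: P_def)
  ultimately show ?thesis using that by (auto simp: P_def)
qed

text \<open>
  If \<open>b\<close> is a root, \<open>T\<^sub>a\<^sub>,\<^sub>b\<^sub>,\<^sub>c\<close> serves to eliminate \<open>b\<close>; otherwise it serves to replace the
  predecessor \<open>b\<close> of \<open>c\<close> by the root \<open>a\<close>.
\<close>

definition needed :: "(nat \<times> nat) set \<Rightarrow> nat \<Rightarrow> nat \<Rightarrow> nat \<Rightarrow> bool" where
  "needed E a b c \<longleftrightarrow> distinct_triple n a b c \<and> a \<in> roots n E \<and> c \<in> roots n E \<and>
     (b \<in> roots n E \<or> (a, b) \<in> E \<and> (c, b) \<notin> E)"

section \<open>Elimination of the sources when every transitivity clause required is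
  available\<close>

text \<open>Start from the initial clause saying that \<open>i\<close> has a predecessor. A
  non-source \<open>j\<close> without an edge from \<open>i\<close> has a source \<open>p j\<close>
  with an edge to it; resolving with \<open>T_clause (p j) j i\<close> replaces \<open>j\<close> by
  \<open>p j\<close> as predecessor of \<open>i\<close> and adds only a literal falsified by
  \<open>E\<close>. Non-sources with an edge from \<open>i\<close> stay, their literals being
  falsified already.\<close>

lemma elim_clause_base:
  assumes E: "oriented n E" "covered n E" and F: "GGT n r s \<subseteq> L"
    and T: "\<And>a b c. needed E a b c \<Longrightarrow> avail L E (T_clause a b c)"
    and i: "i \<in> roots n E"
  obtains P where
    "derives L E (edge_vars E \<union> {xvar j l | j l. j \<in> roots n E \<and> l \<in> roots n E}) (elim_clause n E n i) P"
    "num_clauses P \<le> 1 + 2 * n" "input_derivation P"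
proof -
  define J where "J = {j. j < n \<and> j \<notin> roots n E \<and> (i, j) \<notin> E}"
  define X where "X = {xlit j i | j. j < n \<and> j \<noteq> i}"
  have i': "i < n" "\<And>j. (j, i) \<notin> E" using i by (auto simp: roots_def)
  have irr: "\<And>j. (j, j) \<notin> E" using E by (auto simp: oriented_def)
  have "\<forall>j\<in>J. \<exists>p. p \<in> roots n E \<and> (p, j) \<in> E"
    using E(2) by (auto simp: covered_def J_def)
  then obtain p where p: "\<And>j. j \<in> J \<Longrightarrow> p j \<in> roots n E" "\<And>j. j \<in> J \<Longrightarrow> (p j, j) \<in> E"
    by metis
  have pi: "p j \<noteq> i" "p j < n" "p j \<noteq> j" "j \<noteq> i" "j < n" if "j \<in> J" for j
    using p[OF that] that i irr by (auto simp: J_def roots_def)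
  have Jfin: "finite J" "card J \<le> n"
    using card_mono[of "{..<n}" J] by (auto simp: J_def)
  have TJ: "T_clause (p j) j i = {xlit j (p j), xlit i j, xlit (p j) i}" if "j \<in> J" for j
    using pi[OF that] by (simp add: T_clause_eq)
  let ?U = "UNIV - (\<lambda>j. xvar j i) ` J"
  have "X \<in> L" using F i'(1) by (auto simp: GGT_def X_def)
  then have "derives L E UNIV X (Leaf X)" by (intro derives_Leaf) auto
  then have "\<exists>Q. derives L E ?U
      ((X - (\<lambda>j. xlit j i) ` J) \<union> (\<Union>j\<in>J. T_clause (p j) j i - {xlit i j})) Q \<and>
      num_clauses Q = num_clauses (Leaf X) + 2 * card J \<and>
      (input_derivation (Leaf X) \<longrightarrow> input_derivation Q) \<and> learned (Leaf X) \<subseteq> learned Q"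
  proof (rule derives_chain[OF Jfin(1)])
    fix j assume j: "j \<in> J"
    show "avail L E (T_clause (p j) j i)"
      using p[OF j] pi[OF j] i i' j by (intro T) (auto simp: needed_def distinct_triple_def J_def)
    show "j \<noteq> i \<and> (j, i) \<notin> E \<and> (i, j) \<notin> E"
      using j i' pi[OF j] by (auto simp: J_def)
    show "xlit j i \<in> X \<and> xlit i j \<notin> X"
      using j pi[OF j] by (auto simp: X_def)
    show "xlit i j \<in> T_clause (p j) j i" by (simp add: TJ[OF j])
    fix k assume k: "k \<in> J"
    show "xvar j i = xvar k i \<Longrightarrow> j = k" by auto
    show "xlit k i \<notin> T_clause (p j) j i"
      using pi[OF k] pi[OF j] p(1)[OF j] k by (auto simp: TJ[OF j] J_def)
    show "xlit i k \<in> T_clause (p j) j i \<Longrightarrow> j = k"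
      using pi[OF k] pi[OF j] by (auto simp: TJ[OF j])
  qed auto
  then obtain Q where Q: "derives L E ?U
      ((X - (\<lambda>j. xlit j i) ` J) \<union> (\<Union>j\<in>J. T_clause (p j) j i - {xlit i j})) Q"
      "num_clauses Q = 1 + 2 * card J" "input_derivation Q"
    by auto
  have "derives L E (edge_vars E \<union> {xvar j l | j l. j \<in> roots n E \<and> l \<in> roots n E})
      (elim_clause n E n i) Q"
  proof (rule derives_cong[OF Q(1)])
    have "j \<noteq> i" if "(i, j) \<in> E" for j using that irr by auto
    moreover have "j < n" if "(i, j) \<in> E" for j using that E by (auto simp: oriented_def)
    ultimately show "elim_clause n E n i \<subseteq>
        X - (\<lambda>j. xlit j i) ` J \<union> (\<Union>j\<in>J. T_clause (p j) j i - {xlit i j})"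
      by (auto simp: elim_clause_def X_def J_def negs_def roots_def)
    show "X - (\<lambda>j. xlit j i) ` J \<union> (\<Union>j\<in>J. T_clause (p j) j i - {xlit i j})
        \<subseteq> elim_clause n E n i \<union> negs E"
    proof -
      have "X - (\<lambda>j. xlit j i) ` J \<subseteq> elim_clause n E n i \<union> negs E"
        using i by (auto simp: X_def J_def)
      moreover have "T_clause (p j) j i - {xlit i j} \<subseteq> elim_clause n E n i \<union> negs E"
        if "j \<in> J" for j
        using p[OF that] pi[OF that] by (auto simp: TJ[OF that])
      ultimately show ?thesis by blast
    qed
    show "edge_vars E \<union> {xvar j l | j l. j \<in> roots n E \<and> l \<in> roots n E} \<subseteq> ?U"
    proof -
      have "xvar j i \<notin> edge_vars E" if "j \<in> J" for j
        using that i' by (auto simp: J_def)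
      moreover have "xvar j i \<noteq> xvar k l" if "j \<in> J" "k \<in> roots n E" "l \<in> roots n E" for j k l
        using that by (auto simp: J_def)
      ultimately show ?thesis by blast
    qed
  qed
  with Q Jfin(2) show ?thesis using that by auto
qed

text \<open>The variables to be spared at level \<open>m\<close>: those of \<open>E\<close>, which
  are branched on nearer the root, and those between sources not yet eliminated.\<close>

definition elim_vars :: "(nat \<times> nat) set \<Rightarrow> nat \<Rightarrow> (nat \<times> nat) set" where
  "elim_vars E m =
     edge_vars E \<union> {xvar j l | j l. j \<in> roots n E \<and> l \<in> roots n E \<and> j < m \<and> l < m}"

lemma xvar_in_elim_vars [simp]:
  "xvar j l \<in> elim_vars E m \<longleftrightarrow>
     (j, l) \<in> E \<or> (l, j) \<in> E \<or> j \<in> roots n E \<and> l \<in> roots n E \<and> j < m \<and> l < m"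
  by (auto simp: elim_vars_def)

lemma elim_vars_mono: "m \<le> m' \<Longrightarrow> elim_vars E m \<subseteq> elim_vars E m'"
  unfolding elim_vars_def using order_less_le_trans[of _ m m'] by blast

lemma elim_vars_Suc:
  "m \<in> roots n E \<Longrightarrow> i \<in> roots n E \<Longrightarrow> i < m \<Longrightarrow>
     insert (xvar i m) (elim_vars E m) \<subseteq> elim_vars E (m + 1)"
  using elim_vars_mono[of m "m + 1" E] by simp

lemma Un_eq_insertI: "A = insert x B \<Longrightarrow> V \<subseteq> insert x C \<Longrightarrow> C \<subseteq> V \<Longrightarrow> A \<union> V = insert x (C \<union> B)"
  by blast

text \<open>The first half of eliminating \<open>m\<close>: each possible predecessor
  \<open>j\<close> of \<open>m\<close> other than \<open>i\<close> is turned into a predecessor of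
  \<open>i\<close> by \<open>T_clause j m i\<close>. What remains about \<open>m\<close> is
  \<open>xlit i m\<close>, the pivot for the clause of \<open>i\<close> at level
  \<open>m + 1\<close>.\<close>

lemma elim_clause_chain:
  assumes T: "\<And>a b c. needed E a b c \<Longrightarrow> avail L E (T_clause a b c)"
    and m: "m \<in> roots n E" and i: "i \<in> roots n E" "i < m"
    and P: "derives L E (elim_vars E (m + 1)) (elim_clause n E (m + 1) m) P"
  obtains Q where
    "derives L E (insert (xvar i m) (elim_vars E m))
       (insert (xlit i m) ({xlit j i | j. j \<in> roots n E \<and> j < m \<and> j \<noteq> i} \<union>
          negs {(l, j) \<in> E. l \<in> roots n E \<and> l \<ge> m})) Q"
    "num_clauses Q \<le> num_clauses P + 2 * n"
    "input_derivation P \<Longrightarrow> input_derivation Q" "learned P \<subseteq> learned Q"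
proof -
  define J where "J = {j \<in> roots n E. j < m \<and> j \<noteq> i}"
  have mn: "m < n" using m by (auto simp: roots_def)
  have Jfin: "finite J" "card J \<le> n"
    using card_mono[of "{..<n}" J] mn by (auto simp: J_def roots_def)
  have rE: "(j, k) \<notin> E" if "k \<in> roots n E" for j k using that by (auto simp: roots_def)
  have J: "j \<in> roots n E" "j < m" "j \<noteq> i" if "j \<in> J" for j using that by (auto simp: J_def)
  have TJ: "T_clause j m i = {xlit m j, xlit i m, xlit j i}" if "j \<in> J" for j
    using J[OF that] i by (simp add: T_clause_eq)
  let ?X = "elim_clause n E (m + 1) m"
  have "\<exists>Q. derives L E (elim_vars E (m + 1) - (\<lambda>j. xvar j m) ` J)
      ((?X - (\<lambda>j. xlit j m) ` J) \<union> (\<Union>j\<in>J. T_clause j m i - {xlit m j})) Q \<and>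
      num_clauses Q = num_clauses P + 2 * card J \<and>
      (input_derivation P \<longrightarrow> input_derivation Q) \<and> learned P \<subseteq> learned Q"
  proof (rule derives_chain[OF Jfin(1) P])
    show "(\<lambda>j. xvar j m) ` J \<subseteq> elim_vars E (m + 1)"
      using m J by (intro image_subsetI) (simp add: less_SucI)
    fix j assume j: "j \<in> J"
    show "avail L E (T_clause j m i)"
      using J[OF j] i m by (intro T) (auto simp: needed_def distinct_triple_def roots_def)
    show "j \<noteq> m \<and> (j, m) \<notin> E \<and> (m, j) \<notin> E"
      using J[OF j] m rE by auto
    show "xlit j m \<in> ?X \<and> xlit m j \<notin> ?X"
      using J[OF j] rE by auto
    show "xlit m j \<in> T_clause j m i" by (simp add: TJ[OF j])
    fix k assume k: "k \<in> J"
    show "xvar j m = xvar k m \<Longrightarrow> j = k" by auto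
    show "xlit k m \<notin> T_clause j m i" "xlit m k \<in> T_clause j m i \<Longrightarrow> j = k"
      using J[OF k] J[OF j] i by (auto simp: TJ[OF j])
  qed
  then obtain Q where Q: "derives L E (elim_vars E (m + 1) - (\<lambda>j. xvar j m) ` J)
      ((?X - (\<lambda>j. xlit j m) ` J) \<union> (\<Union>j\<in>J. T_clause j m i - {xlit m j})) Q"
      "num_clauses Q = num_clauses P + 2 * card J"
      "input_derivation P \<longrightarrow> input_derivation Q" "learned P \<subseteq> learned Q"
    by auto
  have iJ: "i \<notin> J" "j \<in> J \<Longrightarrow> (m, j) \<notin> E" for j
    using J rE by blast+
  have "?X - (\<lambda>j. xlit j m) ` J =
      insert (xlit i m) (negs {(l, j) \<in> E. l \<in> roots n E \<and> l \<ge> m})" (is "?A = ?B")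
  proof
    show "?A \<subseteq> ?B"
      by (auto simp: elim_clause_def J_def negs_def)
    show "?B \<subseteq> ?A"
      using i m iJ by (auto simp: elim_clause_def negs_def)
  qed
  moreover have "(\<Union>j\<in>J. T_clause j m i - {xlit m j}) \<subseteq> insert (xlit i m) {xlit j i | j. j \<in> J}"
    using TJ by auto
  moreover have "{xlit j i | j. j \<in> J} \<subseteq> (\<Union>j\<in>J. T_clause j m i - {xlit m j})"
    using TJ i(2) by auto
  ultimately have "(?X - (\<lambda>j. xlit j m) ` J) \<union> (\<Union>j\<in>J. T_clause j m i - {xlit m j}) =
      insert (xlit i m) ({xlit j i | j. j \<in> J} \<union>
        negs {(l, j) \<in> E. l \<in> roots n E \<and> l \<ge> m})"
    by (rule Un_eq_insertI)
  with Q(1) have 1: "derives L E (elim_vars E (m + 1) - (\<lambda>j. xvar j m) ` J)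
      (insert (xlit i m) ({xlit j i | j. j \<in> J} \<union>
        negs {(l, j) \<in> E. l \<in> roots n E \<and> l \<ge> m})) Q"
    by simp
  have "xvar j m \<noteq> xvar i m" "xvar j m \<notin> elim_vars E m" if "j \<in> J" for j
    using J[OF that] m i rE by auto
  then have "(\<lambda>j. xvar j m) ` J \<inter> insert (xvar i m) (elim_vars E m) = {}"
    by blast
  with elim_vars_Suc[OF m i] have "insert (xvar i m) (elim_vars E m) \<subseteq>
      elim_vars E (m + 1) - (\<lambda>j. xvar j m) ` J"
    by blast
  from derives_cong[OF 1 subset_refl Un_upper1 this] show ?thesis
    using that Q Jfin by (auto simp: J_def conj_assoc)
qed

text \<open>Amortized over \<open>unelim\<close>. A derivation that is not a single leaf makes some
  new elimination clause available, possibly only inside a subderivation, and this pays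
  \<open>2 * n + 2\<close> at the current level. One new clause may be charged at each of the
  \<open>n + 1 - m\<close> levels, whence the weight.\<close>

lemma elim_clause_derivable:
  assumes E: "oriented n E" "covered n E" and F: "GGT n r s \<subseteq> L"
    and T: "\<And>a b c. needed E a b c \<Longrightarrow> avail L E (T_clause a b c)"
    and "i \<in> roots n E" "i < m" "m \<le> n"
  shows "\<exists>P. derives L E (elim_vars E m) (elim_clause n E m i) P \<and>
    num_clauses P + (2 * n + 2) * (n + 1 - m) * unelim n E (L \<union> learned P) \<le>
      1 + (2 * n + 2) * (n + 1 - m) * unelim n E L \<and>
    (is_leaf P \<or> unelim n E (L \<union> learned P) < unelim n E L)"
  using assms(3-)
proof (induction "n - m" arbitrary: m i L)
  case 0
  then have m: "m = n" by simp
  show ?case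
  proof (cases "avail L E (elim_clause n E m i)")
    case True
    then obtain C where "derives L E (elim_vars E m) (elim_clause n E m i) (Leaf C)"
      by (rule avail_derives)
    moreover have "unelim n E (L \<union> learned (Leaf C)) \<le> unelim n E L"
      by (intro unelim_mono) auto
    ultimately show ?thesis by (intro exI[of _ "Leaf C"]) auto
  next
    case False
    obtain P where P: "derives L E (edge_vars E \<union>
          {xvar j l | j l. j \<in> roots n E \<and> l \<in> roots n E}) (elim_clause n E n i) P"
        "num_clauses P \<le> 1 + 2 * n" "input_derivation P"
      using elim_clause_base[OF E 0(2,3,4)] by blast
    have "derives L E (elim_vars E m) (elim_clause n E m i) P"
      unfolding m by (rule derives_cong[OF P(1)]) (auto simp: elim_vars_def)
    moreover have less: "unelim n E (L \<union> learned P) < unelim n E L"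
      using unelim_less[OF Un_upper1 _ _ _ False derives_input_avail[OF calculation P(3)]] 0 by auto
    moreover have "num_clauses P + (2 * n + 2) * unelim n E (L \<union> learned P) \<le>
        1 + (2 * n + 2) * unelim n E L"
      using P(2) mult_le_mono2[OF Suc_leI[OF less], of "2 * n + 2"] by simp
    ultimately show ?thesis using m by auto
  qed
next
  case (Suc d)
  define c where "c = 2 * n + 2"
  define e where "e = n + 1 - (m + 1)"
  have m: "m < n" "n + 1 - m = e + 1" "d = n - (m + 1)" using Suc(2) by (auto simp: e_def)
  have split: "c * (e + 1) * x = c * e * x + c * x" for x
    by (simp add: algebra_simps)
  note IH = Suc(1)[OF m(3), folded c_def e_def]
  show ?case unfolding c_def[symmetric]
  proof (cases "avail L E (elim_clause n E m i)")
    case True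
    then obtain C where "derives L E (elim_vars E m) (elim_clause n E m i) (Leaf C)"
      by (rule avail_derives)
    moreover have "unelim n E (L \<union> learned (Leaf C)) \<le> unelim n E L"
      by (intro unelim_mono) auto
    ultimately show "\<exists>P. derives L E (elim_vars E m) (elim_clause n E m i) P \<and>
      num_clauses P + c * (n + 1 - m) * unelim n E (L \<union> learned P) \<le>
        1 + c * (n + 1 - m) * unelim n E L \<and>
      (is_leaf P \<or> unelim n E (L \<union> learned P) < unelim n E L)"
      by (intro exI[of _ "Leaf C"]) auto
  next
    case False
    show "\<exists>P. derives L E (elim_vars E m) (elim_clause n E m i) P \<and>
      num_clauses P + c * (n + 1 - m) * unelim n E (L \<union> learned P) \<le>
        1 + c * (n + 1 - m) * unelim n E L \<and>
      (is_leaf P \<or> unelim n E (L \<union> learned P) < unelim n E L)"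
    proof (cases "m \<in> roots n E")
      case mr: False
      obtain P where P: "derives L E (elim_vars E (m + 1)) (elim_clause n E (m + 1) i) P"
        "num_clauses P + c * e * unelim n E (L \<union> learned P) \<le> 1 + c * e * unelim n E L"
        "is_leaf P \<or> unelim n E (L \<union> learned P) < unelim n E L"
        using IH[of L i] Suc.prems m by auto
      \<comment> \<open>If \<open>m\<close> is not a source, levels \<open>m\<close> and
        \<open>m + 1\<close> coincide.\<close>
      have lt: "j < Suc m \<longleftrightarrow> j < m" "Suc m \<le> j \<longleftrightarrow> m \<le> j" if "j \<in> roots n E" for j
        using mr that by (cases "j = m"; auto)+
      have "elim_clause n E (m + 1) i = elim_clause n E m i" "elim_vars E (m + 1) = elim_vars E m"
        using lt by (auto simp: elim_clause_def elim_vars_def negs_def simp del: xvar_eq_iff)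
      moreover have "c * unelim n E (L \<union> learned P) \<le> c * unelim n E L"
        by (intro mult_le_mono2 unelim_mono) auto
      with P(2) have "num_clauses P + c * (e + 1) * unelim n E (L \<union> learned P) \<le>
          1 + c * (e + 1) * unelim n E L"
        unfolding split by linarith
      ultimately show ?thesis
        using P(1,3) unfolding m(2) by metis
    next
      case mr: True
      obtain P1 where P1: "derives L E (elim_vars E (m + 1)) (elim_clause n E (m + 1) m) P1"
        "num_clauses P1 + c * e * unelim n E (L \<union> learned P1) \<le> 1 + c * e * unelim n E L"
        "is_leaf P1 \<or> unelim n E (L \<union> learned P1) < unelim n E L"
        using IH[of L m] Suc.prems m mr by auto
      obtain P2 where P2: "derives L E (insert (xvar i m) (elim_vars E m))
         (insert (xlit i m) ({xlit j i | j. j \<in> roots n E \<and> j < m \<and> j \<noteq> i} \<union>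
            negs {(l, j) \<in> E. l \<in> roots n E \<and> l \<ge> m})) P2"
        "num_clauses P2 \<le> num_clauses P1 + 2 * n"
        "input_derivation P1 \<Longrightarrow> input_derivation P2" "learned P1 \<subseteq> learned P2"
        using elim_clause_chain[OF Suc.prems(2) mr Suc.prems(3,4) P1(1)] by blast
      define L2 where "L2 = L \<union> learned P2"
      have GL2: "GGT n r s \<subseteq> L2" using Suc.prems(1) by (auto simp: L2_def)
      have "avail L2 E (T_clause a b c)" if "needed E a b c" for a b c
        using Suc.prems(2)[OF that] avail_mono unfolding L2_def by blast
      then obtain P3 where P3: "derives L2 E (elim_vars E (m + 1)) (elim_clause n E (m + 1) i) P3"
        "num_clauses P3 + c * e * unelim n E (L2 \<union> learned P3) \<le> 1 + c * e * unelim n E L2"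
        "is_leaf P3 \<or> unelim n E (L2 \<union> learned P3) < unelim n E L2"
        using IH[of L2 i] Suc.prems(3,4) m GL2 by auto
      define P where "P = resolve i m P2 P3"
      have sub: "insert (xvar i m) (elim_vars E m) \<subseteq> elim_vars E (m + 1)"
        using Suc.prems(3,4) mr by (intro elim_vars_Suc)
      have rE: "(j, k) \<notin> E" if "k \<in> roots n E" for j k using that by (auto simp: roots_def)
      let ?X = "insert (xlit i m) ({xlit j i | j. j \<in> roots n E \<and> j < m \<and> j \<noteq> i} \<union>
            negs {(l, j) \<in> E. l \<in> roots n E \<and> l \<ge> m})"
      have "derives L E (elim_vars E m) ((?X - {xlit i m}) \<union> (elim_clause n E (m + 1) i - {xlit m i})) P"
        unfolding P_def
      proof (rule derives_resolve[OF P2(1)])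
        show "derives (L \<union> learned P2) E (insert (xvar i m) (elim_vars E m)) (elim_clause n E (m + 1) i) P3"
          using derives_cong[OF P3(1) subset_refl Un_upper1 sub] by (simp add: L2_def)
        show "xvar i m \<notin> elim_vars E m"
          using rE mr Suc.prems(3) by auto
      qed (use rE mr Suc.prems(3,4) in auto)
      moreover have "(?X - {xlit i m}) \<union> (elim_clause n E (m + 1) i - {xlit m i}) =
          elim_clause n E m i" (is "?A = ?B")
      proof
        show "?A \<subseteq> ?B"
          by (auto simp: elim_clause_def negs_def less_Suc_eq)
        show "?B \<subseteq> ?A"
          using rE mr Suc.prems(3,4) by (auto simp: elim_clause_def negs_def less_Suc_eq)
      qed
      ultimately have P: "derives L E (elim_vars E m) (elim_clause n E m i) P" by simp
      let ?w = "unelim n E L" and ?w' = "unelim n E (L \<union> learned P)"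
      have L2P: "L2 \<subseteq> L \<union> learned P" "L2 \<union> learned P3 \<subseteq> L \<union> learned P" "L \<union> learned P1 \<subseteq> L2"
        using learned_resolve[of P2 P3 i m] P2(4) by (auto simp: P_def L2_def)
      have le: "?w' \<le> unelim n E (L2 \<union> learned P3)" "unelim n E (L2 \<union> learned P3) \<le> unelim n E L2"
          "unelim n E L2 \<le> unelim n E (L \<union> learned P1)" "unelim n E (L \<union> learned P1) \<le> ?w"
        using L2P by (auto intro!: unelim_mono)
      \<comment> \<open>If both premises from level \<open>m + 1\<close> are leaves, the whole
        derivation is an input derivation and its conclusion becomes a lemma. Otherwise one of the
        two has already made progress.\<close>
      have less: "?w' < ?w"
      proof (cases "is_leaf P1 \<and> is_leaf P3")
        case True
        then have "input_derivation P1" "input_derivation P3" by (cases P1; cases P3; auto)+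
        with True P2(3) have "input_derivation P" by (simp add: P_def)
        from derives_input_avail[OF P this] show ?thesis
          using unelim_less[OF Un_upper1 _ _ _ False] Suc.prems by blast
      next
        case False
        with P1(3) P3(3) le show ?thesis by linarith
      qed
      \<comment> \<open>The overhead is \<open>2 * n\<close> for the chain and 1 for the last
        inference; the missing 1 of \<open>c\<close> absorbs the second additive 1 of the two
        induction hypotheses.\<close>
      have "num_clauses P \<le> num_clauses P1 + num_clauses P3 + (c - 1)"
        using P2(2) by (simp add: P_def c_def)
      moreover have "c * e * ?w' \<le> c * e * unelim n E (L2 \<union> learned P3)"
        "c * e * unelim n E L2 \<le> c * e * unelim n E (L \<union> learned P1)"
        using le by (auto intro!: mult_le_mono2)
      moreover have "c * ?w' + c \<le> c * ?w"
        using mult_le_mono2[OF Suc_leI[OF less], of c] by simp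
      ultimately have "num_clauses P + c * (e + 1) * ?w' \<le> 1 + c * (e + 1) * ?w"
        using P1(2) P3(2) c_def unfolding split by linarith
      then show ?thesis
        using P less unfolding m(2) by metis
    qed
  qed
qed

section \<open>Branching on a missing transitivity clause\<close>

lemma roots_insert [simp]: "roots n (insert (i, j) E) = roots n E - {j}"
  by (auto simp: roots_def)

lemma weakly_coveredI:
  assumes "covered n E" "E \<subseteq> E'" "a \<in> roots n E'"
    and "\<And>x. x \<in> roots n E \<Longrightarrow> x \<notin> roots n E' \<Longrightarrow> (a, x) \<in> E'"
  shows "weakly_covered n E'"
  unfolding weakly_covered_def
proof (intro allI impI)
  fix l assume l: "l < n" "l \<notin> roots n E'"
  show "\<exists>p\<in>roots n E'. (p, l) \<in> E' \<or> (\<exists>j. (p, j) \<in> E' \<and> (j, l) \<in> E')"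
  proof (cases "l \<in> roots n E")
    case True
    with assms(3,4) l show ?thesis by blast
  next
    case False
    with assms(1) l obtain p where p: "p \<in> roots n E" "(p, l) \<in> E"
      by (auto simp: covered_def)
    with assms(2-4) show ?thesis by (cases "p \<in> roots n E'") blast+
  qed
qed

text \<open>Eliminating down to the least source \<open>i\<close> leaves no possible predecessor, so
  the clause at level \<open>i + 1\<close> is \<open>root_clause n E\<close>. Covering guarantees
  that a source exists.\<close>

lemma refute_covered:
  assumes E: "oriented n E" "covered n E" and F: "GGT n r s \<subseteq> L"
    and T: "\<And>a b c. needed E a b c \<Longrightarrow> avail L E (T_clause a b c)"
  obtains P where "derives L E (edge_vars E) (root_clause n E) P"
    "num_clauses P \<le> 1 + 2 * (n + 1) ^ 4"
proof -
  define i where "i = (LEAST i. i \<in> roots n E)"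
  have "\<exists>i. i \<in> roots n E"
    using E(2) n unfolding covered_def by (metis less_trans zero_less_one)
  then have i: "i \<in> roots n E" "\<And>j. j \<in> roots n E \<Longrightarrow> i \<le> j"
    unfolding i_def by (auto intro: LeastI_ex Least_le)
  then have "i < n" by (auto simp: roots_def)
  then obtain P where P: "derives L E (elim_vars E (i + 1)) (elim_clause n E (i + 1) i) P"
    "num_clauses P + (2 * n + 2) * (n + 1 - (i + 1)) * unelim n E (L \<union> learned P) \<le>
      1 + (2 * n + 2) * (n + 1 - (i + 1)) * unelim n E L"
    using elim_clause_derivable[OF E F T i(1), of "i + 1"] by auto
  have ge: "Suc i \<le> l" if "l \<in> roots n E" "l \<noteq> i" for l
    using i(2)[OF that(1)] that(2) by simp
  have le: "j = i" if "j \<in> roots n E" "j < Suc i" for j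
    using i(2)[OF that(1)] that(2) by simp
  have "{(l, j) \<in> E. l \<in> roots n E \<and> (l = i \<or> l \<ge> i + 1)} = {(l, j) \<in> E. l \<in> roots n E}"
    using ge by auto
  moreover have "{xlit j i | j. j \<in> roots n E \<and> j < i + 1 \<and> j \<noteq> i} = {}"
    using le by auto
  ultimately have "elim_clause n E (i + 1) i = root_clause n E"
    unfolding elim_clause_def root_clause_def by (simp only: Un_empty_left)
  moreover have "edge_vars E \<subseteq> elim_vars E (i + 1)" by (auto simp: elim_vars_def)
  ultimately have "derives L E (edge_vars E) (root_clause n E) P"
    using derives_cong[OF P(1) subset_refl Un_upper1] by simp
  moreover have "num_clauses P \<le> 1 + (2 * n + 2) * (n + 1) * ((n + 1) * (n + 1))"
  proof -
    have "num_clauses P \<le> 1 + (2 * n + 2) * (n + 1 - (i + 1)) * unelim n E L"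
      using P(2) by linarith
    also have "\<dots> \<le> 1 + (2 * n + 2) * (n + 1) * ((n + 1) * (n + 1))"
      by (intro add_left_mono mult_le_mono unelim_le) auto
    finally show ?thesis .
  qed
  moreover have "(2 * n + 2) * (n + 1) * ((n + 1) * (n + 1)) = 2 * (n + 1) ^ 4"
    by (simp add: power4_eq_xxxx algebra_simps)
  ultimately show ?thesis using that by simp
qed

text \<open>
  In both branches that satisfy \<open>T\<^sub>a\<^sub>,\<^sub>b\<^sub>,\<^sub>c\<close>, the literal to be resolved on is that of an edge leaving
  a root and hence occurs in \<open>root_clause\<close>.
\<close>

lemma learn_T:
  assumes F: "GGT n r s \<subseteq> L" and E: "oriented n E" and abc: "distinct_triple n a b c"
    and ab: "(a, b) \<in> E" and ac: "a \<in> roots n E" "c \<in> roots n E" and cb: "(c, b) \<notin> E"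
    and T: "\<not> avail L E (T_clause a b c)"
    and IH: "\<And>L' E'. L \<subseteq> L' \<Longrightarrow> unlearned n L' < unlearned n L \<Longrightarrow>
        oriented n E' \<Longrightarrow> weakly_covered n E' \<Longrightarrow>
        \<exists>P. derives L' E' (edge_vars E') (root_clause n E') P \<and>
          num_clauses P + B * unlearned n (L' \<union> learned P) \<le> D + B * unlearned n L'"
    and wc: "weakly_covered n (insert (a, c) (insert (b, c) E))" "weakly_covered n (insert (c, b) E)"
  obtains P where "derives L E (edge_vars E) (root_clause n E) P"
    "unlearned n (L \<union> learned P) < unlearned n L"
    "num_clauses P + B * unlearned n (L \<union> learned P) + B \<le> 2 * D + 5 + B * unlearned n L"
proof -
  have d: "a \<noteq> b" "b \<noteq> c" "a \<noteq> c" "a < n" "b < n" "c < n"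
    using abc by (auto simp: distinct_triple_def)
  have nE: "(x, c) \<notin> E" "(x, a) \<notin> E" for x using ac by (auto simp: roots_def)
  have br: "b \<notin> roots n E" using ab by (auto simp: roots_def)
  have Teq: "T_clause a b c = {xlit b a, xlit c b, xlit a c}"
    using d by (simp add: T_clause_eq)
  \<comment> \<open>\<open>P0\<close> closes the branch with edges \<open>(b, c)\<close> and
    \<open>(c, a)\<close>, \<open>P1\<close> continues with \<open>(b, c)\<close> and
    \<open>(a, c)\<close>, and \<open>P2\<close> with \<open>(c, b)\<close>. \<open>P0\<close> comes
    first in postorder, so the learned clause is at hand in the other two.\<close>
  let ?U = "insert (xvar a c) (insert (xvar b c) (edge_vars E))"
  let ?E = "insert (b, c) E"
  have "?U \<subseteq> edge_vars E \<union> {xvar a b, xvar b c, xvar c a}"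
    using xvar_commute[of a c] by blast
  from T_derivable[OF abc F this] T
  obtain P0 where P0: "derives L E ?U (T_clause a b c) P0" "num_clauses P0 \<le> 3"
    "T_clause a b c \<in> learned P0" by blast
  define L1 where "L1 = L \<union> learned P0"
  have TL: "T_clause a b c \<notin> L" using T by (auto simp: avail_def)
  have less: "unlearned n L1 < unlearned n L"
    by (rule unlearned_less[OF _ abc TL]) (use P0(3) in \<open>auto simp: L1_def\<close>)
  have "oriented n (insert (a, c) ?E)"
    by (intro oriented_insert E) (use d nE cb in auto)
  from IH[OF _ less this wc(1)] obtain P1 where
    P1: "derives L1 (insert (a, c) ?E) (edge_vars (insert (a, c) ?E))
        (root_clause n (insert (a, c) ?E)) P1"
      "num_clauses P1 + B * unlearned n (L1 \<union> learned P1) \<le> D + B * unlearned n L1"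
    by (auto simp: L1_def)
  let ?R1 = "root_clause n (insert (a, c) ?E)"
  define P01 where "P01 = resolve a c P0 P1"
  have ca: "xlit c a \<in> ?R1" using ac d by simp
  have "derives L ?E (edge_vars ?E) ((T_clause a b c - {xlit a c}) \<union> (?R1 - {xlit c a})) P01"
    unfolding P01_def
  proof (rule derives_resolve)
    show "derives L ?E (insert (xvar a c) (edge_vars ?E)) (T_clause a b c) P0"
      using derives_add_edge[OF P0(1)] by simp
    show "derives (L \<union> learned P0) ?E (insert (xvar a c) (edge_vars ?E)) ?R1 P1"
      using derives_drop_edge[OF P1(1) ca] by (simp add: L1_def)
  qed (use nE d ca in \<open>auto simp: Teq\<close>)
  \<comment> \<open>The edge \<open>(b, c)\<close> leaves a non-source, so \<open>?R1\<close> does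
    not supply its literal; \<open>T_clause a b c\<close> does.\<close>
  then have P01: "derives L E (insert (xvar c b) (edge_vars E))
      ((T_clause a b c - {xlit a c}) \<union> (?R1 - {xlit c a})) P01"
    using derives_drop_edge[of L b c E] d by (simp add: Teq xvar_commute[of c b])
  define L2 where "L2 = L \<union> learned P01"
  have L2: "L1 \<union> learned P1 \<subseteq> L2"
    using learned_resolve[of P0 P1 a c] by (auto simp: L1_def L2_def P01_def)
  then have less2: "unlearned n L2 < unlearned n L"
    using less unlearned_mono[of L1 L2 n] by auto
  have "oriented n (insert (c, b) E)"
    by (intro oriented_insert E) (use d nE cb in auto)
  from IH[OF _ less2 this wc(2)] obtain P2 where
    P2: "derives L2 (insert (c, b) E) (edge_vars (insert (c, b) E))
        (root_clause n (insert (c, b) E)) P2"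
      "num_clauses P2 + B * unlearned n (L2 \<union> learned P2) \<le> D + B * unlearned n L2"
    by (auto simp: L2_def)
  let ?R2 = "root_clause n (insert (c, b) E)"
  have bc: "xlit b c \<in> ?R2" using ac d by simp
  define P where "P = resolve c b P01 P2"
  let ?X = "((T_clause a b c - {xlit a c}) \<union> (?R1 - {xlit c a}) - {xlit c b}) \<union> (?R2 - {xlit b c})"
  have "derives L E (edge_vars E) ?X P"
    unfolding P_def
  proof (rule derives_resolve[OF P01])
    show "derives (L \<union> learned P01) E (insert (xvar c b) (edge_vars E)) ?R2 P2"
      using derives_drop_edge[OF P2(1) bc] by (simp add: L2_def)
  qed (use nE d bc cb ac br in \<open>auto simp: Teq\<close>)
  then have "derives L E (edge_vars E) (root_clause n E) P"
  proof (rule derives_cong)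
    have "?R2 = insert (xlit b c) (root_clause n E)"
      using br ac d by (auto simp: root_clause_def negs_def)
    then show "root_clause n E \<subseteq> ?X" using cb by auto
    have "?R1 \<subseteq> negs (insert (a, c) ?E)" "?R2 \<subseteq> negs (insert (c, b) E)"
      by (rule root_clause_negs)+
    moreover have "T_clause a b c - {xlit a c} \<subseteq> insert (xlit c b) (negs E)"
      using ab by (auto simp: Teq)
    ultimately show "?X \<subseteq> root_clause n E \<union> negs E" by auto
  qed simp
  moreover have L3: "L2 \<union> learned P2 \<subseteq> L \<union> learned P"
    using learned_resolve[of P01 P2 c b] by (auto simp: L2_def P_def)
  have "L2 \<subseteq> L \<union> learned P" using L3 by auto
  then have "unlearned n (L \<union> learned P) < unlearned n L"
    using less2 unlearned_mono[of L2 "L \<union> learned P" n] by linarith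
  moreover have "num_clauses P + B * unlearned n (L \<union> learned P) + B \<le> 2 * D + 5 + B * unlearned n L"
  proof -
    have "B * unlearned n (L \<union> learned P) \<le> B * unlearned n (L2 \<union> learned P2)"
      "B * unlearned n L2 \<le> B * unlearned n (L1 \<union> learned P1)"
      using L2 L3 by (auto intro!: mult_le_mono2 unlearned_mono)
    moreover have "B * unlearned n L1 + B \<le> B * unlearned n L"
      using mult_le_mono2[OF Suc_leI[OF less], of B] by simp
    moreover have "num_clauses P = num_clauses P0 + num_clauses P1 + num_clauses P2 + 2"
      by (simp add: P_def P01_def)
    ultimately show ?thesis using P0(2) P1(2) P2(2) by linarith
  qed
  ultimately show ?thesis using that by blast
qed

section \<open>The complete branching and its size\<close>

text \<open>The sum of \<open>12 * (n * n) + 6\<close>, which makes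
  \<open>3 * D + 6 \<le> 4 * cost\<close> hold for \<open>D = cost + 4 * (n * n)\<close>, and of the
  bound \<open>1 + 2 * (n + 1) ^ 4\<close> for a full elimination.\<close>

definition cost :: nat where
  "cost = 12 * (n * n) + 7 + 2 * (n + 1) ^ 4"

text \<open>Each newly learned triple pays \<open>3 * cost\<close>, enough for up to three continued
  branches, and each shortcut edge pays 4. The induction is lexicographic: \<open>n * n + 1\<close>
  exceeds every value of \<open>n * n - card E\<close>, so learning outweighs any loss of
  edges.\<close>

lemma refute_weakly_covered:
  assumes "GGT n r s \<subseteq> L" "oriented n E" "weakly_covered n E"
  shows "\<exists>P. derives L E (edge_vars E) (root_clause n E) P \<and>
    num_clauses P + 3 * cost * unlearned n (L \<union> learned P) \<le>
      cost + 3 * cost * unlearned n L + 4 * (n * n - card E)"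
  using assms
proof (induction "unlearned n L * (n * n + 1) + (n * n - card E)" arbitrary: L E rule: less_induct)
  case less
  note F = less.prems(1) and E = less.prems(2)
  have fin: "finite E'" "card E' \<le> n * n" if "oriented n E'" for E'
    using that finite_subset[of E' "{..<n} \<times> {..<n}"] card_mono[of "{..<n} \<times> {..<n}" E']
    by (auto simp: oriented_def card_cartesian_product)
  have rE: "(j, k) \<notin> E" if "k \<in> roots n E" for j k using that by (auto simp: roots_def)
  show ?case
  proof (cases "covered n E")
    case False
    then obtain l where l: "l < n" "l \<notin> roots n E" "\<And>p. p \<in> roots n E \<Longrightarrow> (p, l) \<notin> E"
      by (auto simp: covered_def)
    \<comment> \<open>Branching on the variable of \<open>p\<close> and \<open>l\<close> covers
      \<open>l\<close> without changing the sources: the edge \<open>(p, l)\<close> is the shortcut,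
      and \<open>(l, p)\<close> falsifies \<open>T_clause p j l\<close>. That side costs at most 3
      nodes, and the inference one more.\<close>
    with less.prems(3) obtain p j where pj: "p \<in> roots n E" "(p, j) \<in> E" "(j, l) \<in> E"
      unfolding weakly_covered_def by metis
    have d: "p \<noteq> l" "p \<noteq> j" "j \<noteq> l" "p < n" "j < n" "(p, l) \<notin> E" "(l, p) \<notin> E"
    proof -
      have "(x, x) \<notin> E" "(x, y) \<in> E \<Longrightarrow> x < n \<and> y < n" for x y
        using E by (auto simp: oriented_def)
      then show "p \<noteq> l" "p \<noteq> j" "j \<noteq> l" "p < n" "j < n" "(p, l) \<notin> E" "(l, p) \<notin> E"
        using pj l rE by metis+
    qed
    let ?E = "insert (p, l) E"
    have ori: "oriented n ?E" using d l E by (intro oriented_insert) auto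
    have "roots n ?E = roots n E" using l by auto
    then have wc: "weakly_covered n ?E"
      using less.prems(3) unfolding weakly_covered_def by (metis insertCI)
    have card: "card ?E = card E + 1" using d fin[OF E] by simp
    with fin(2)[OF ori] have "unlearned n L * (n * n + 1) + (n * n - card ?E) <
        unlearned n L * (n * n + 1) + (n * n - card E)" by linarith
    from less.hyps[OF this F ori wc] obtain P where
      P: "derives L ?E (edge_vars ?E) (root_clause n ?E) P"
        "num_clauses P + 3 * cost * unlearned n (L \<union> learned P) \<le>
          cost + 3 * cost * unlearned n L + 4 * (n * n - card ?E)"
      by blast
    have T: "T_clause p j l = {xlit j p, xlit l j, xlit p l}"
      using d by (simp add: T_clause_eq)
    have "insert (xvar l p) (edge_vars E) \<subseteq> edge_vars E \<union> {xvar p j, xvar j l, xvar l p}" by blast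
    moreover have "distinct_triple n p j l" "GGT n r s \<subseteq> L \<union> learned P"
      using d l F by (auto simp: distinct_triple_def)
    ultimately obtain Q where Q: "derives (L \<union> learned P) E (insert (xvar l p) (edge_vars E)) (T_clause p j l) Q"
      "num_clauses Q \<le> 3"
      using T_derivable by metis
    define R where "R = resolve l p P Q"
    have lp: "xlit l p \<in> root_clause n ?E" using pj d by simp
    have "derives L E (edge_vars E)
        ((root_clause n ?E - {xlit l p}) \<union> (T_clause p j l - {xlit p l})) R"
      unfolding R_def
    proof (rule derives_resolve[OF _ Q(1)])
      show "derives L E (insert (xvar l p) (edge_vars E)) (root_clause n ?E) P"
        using derives_drop_edge[OF P(1) lp] by (simp add: xvar_commute[of l p])
    qed (use d l lp in \<open>auto simp: T\<close>)
    then have "derives L E (edge_vars E) (root_clause n E) R"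
    proof (rule derives_cong)
      have eq: "root_clause n ?E = insert (xlit l p) (root_clause n E)"
        using l pj d by (auto simp: root_clause_def negs_def)
      then show "root_clause n E \<subseteq>
          (root_clause n ?E - {xlit l p}) \<union> (T_clause p j l - {xlit p l})"
        using d by auto
      show "(root_clause n ?E - {xlit l p}) \<union> (T_clause p j l - {xlit p l}) \<subseteq>
          root_clause n E \<union> negs E"
        unfolding eq using pj by (auto simp: T)
    qed simp
    moreover have "num_clauses R + 3 * cost * unlearned n (L \<union> learned R) \<le>
      cost + 3 * cost * unlearned n L + 4 * (n * n - card E)"
    proof -
      have "3 * cost * unlearned n (L \<union> learned R) \<le> 3 * cost * unlearned n (L \<union> learned P)"
        using learned_resolve[of P Q l p]
        by (intro mult_le_mono2 unlearned_mono) (auto simp: R_def)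
      moreover have "num_clauses R \<le> num_clauses P + 4" using Q(2) by (simp add: R_def)
      ultimately show ?thesis using P(2) card fin(2)[OF ori] by linarith
    qed
    ultimately show ?thesis by blast
  next
    case cov: True
    show ?thesis
    proof (cases "\<forall>a b c. needed E a b c \<longrightarrow> avail L E (T_clause a b c)")
      case True
      then obtain P where P: "derives L E (edge_vars E) (root_clause n E) P"
        "num_clauses P \<le> 1 + 2 * (n + 1) ^ 4"
        using refute_covered[OF E cov F] by blast
      have "3 * cost * unlearned n (L \<union> learned P) \<le> 3 * cost * unlearned n L"
        by (intro mult_le_mono2 unlearned_mono) auto
      moreover have "num_clauses P \<le> cost" using P(2) by (simp add: cost_def)
      ultimately have "num_clauses P + 3 * cost * unlearned n (L \<union> learned P) \<le>
          cost + 3 * cost * unlearned n L + 4 * (n * n - card E)"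
        by linarith
      with P(1) show ?thesis by blast
    next
      case False
      then obtain a b c where abc: "needed E a b c" and T: "\<not> avail L E (T_clause a b c)"
        by blast
      have dist: "distinct_triple n a b c" and ac: "a \<in> roots n E" "c \<in> roots n E"
        using abc by (auto simp: needed_def)
      then have d: "a \<noteq> b" "b \<noteq> c" "a \<noteq> c" "a < n" "b < n" "c < n"
        by (auto simp: distinct_triple_def)
      define D where "D = cost + 4 * (n * n)"
      have IH: "\<exists>P. derives L' E' (edge_vars E') (root_clause n E') P \<and>
          num_clauses P + 3 * cost * unlearned n (L' \<union> learned P) \<le> D + 3 * cost * unlearned n L'"
        if "L \<subseteq> L'" "unlearned n L' < unlearned n L" "oriented n E'" "weakly_covered n E'" for L' E'
      proof -
        have *: "(unlearned n L' + 1) * (n * n + 1) \<le> unlearned n L * (n * n + 1)"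
          using that(2) by (intro mult_le_mono1) simp
        have "unlearned n L' * (n * n + 1) + (n * n - card E') <
            unlearned n L * (n * n + 1) + (n * n - card E)"
        proof -
          have "x + 1 * (q + 1) \<le> y \<Longrightarrow> x + (q - u) < y + w" for x y q u w :: nat by simp
          with * show ?thesis unfolding add_mult_distrib by blast
        qed
        from less.hyps[OF this _ that(3,4)] that(1) F obtain P where
          "derives L' E' (edge_vars E') (root_clause n E') P"
          "num_clauses P + 3 * cost * unlearned n (L' \<union> learned P) \<le>
            cost + 3 * cost * unlearned n L' + 4 * (n * n - card E')"
          by auto
        then show ?thesis by (intro exI[of _ P]) (auto simp: D_def)
      qed
      show ?thesis
      proof (cases "(a, b) \<in> E")
        case ab: True
        then have cb: "(c, b) \<notin> E" "b \<notin> roots n E"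
          using abc rE by (auto simp: needed_def)
        have "weakly_covered n (insert (a, c) (insert (b, c) E))" "weakly_covered n (insert (c, b) E)"
          by (rule weakly_coveredI[OF cov, of _ a]; use ac d cb in auto)+
        from learn_T[OF F E dist ab ac cb(1) T IH this] obtain P where
          P: "derives L E (edge_vars E) (root_clause n E) P"
            "num_clauses P + 3 * cost * unlearned n (L \<union> learned P) + 3 * cost \<le>
              2 * D + 5 + 3 * cost * unlearned n L"
          by blast
        have "2 * D + 5 \<le> 4 * cost" by (simp add: D_def cost_def)
        with P(2) have "num_clauses P + 3 * cost * unlearned n (L \<union> learned P) \<le>
            cost + 3 * cost * unlearned n L + 4 * (n * n - card E)"
          by linarith
        with P(1) show ?thesis by blast
      next
        case ab: False
        then have br: "b \<in> roots n E" using abc by (auto simp: needed_def)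
        \<comment> \<open>When \<open>b\<close> is a source too, first branch on the edge between
          \<open>a\<close> and \<open>b\<close>. The side \<open>?E\<close> is the previous case; it
          learns the clause, so the induction hypothesis applies to the side
          \<open>?E'\<close>.\<close>
        let ?E = "insert (a, b) E" and ?E' = "insert (b, a) E"
        have nE: "(x, a) \<notin> E" "(x, b) \<notin> E" "(x, c) \<notin> E" for x using rE ac br by auto
        have ori: "oriented n ?E" "oriented n ?E'"
          by (intro oriented_insert E; use d nE in auto)+
        \<comment> \<open>The only literal that the new edge adds to \<open>negs E\<close> is
          \<open>xlit b a\<close>, which belongs to the clause already.\<close>
        have "\<not> avail L ?E (T_clause a b c)"
          using T d unfolding avail_def by (auto simp: T_clause_eq)
        moreover have "weakly_covered n (insert (a, c) (insert (b, c) ?E))"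
          "weakly_covered n (insert (c, b) ?E)"
          by (rule weakly_coveredI[OF cov, of _ a]; use ac d in auto)+
        moreover have "a \<in> roots n ?E" "c \<in> roots n ?E" "(c, b) \<notin> ?E"
          using ac d nE by auto
        ultimately obtain P where
          P: "derives L ?E (edge_vars ?E) (root_clause n ?E) P"
            "unlearned n (L \<union> learned P) < unlearned n L"
            "num_clauses P + 3 * cost * unlearned n (L \<union> learned P) + 3 * cost \<le>
              2 * D + 5 + 3 * cost * unlearned n L"
          using learn_T[OF F ori(1) dist insertI1 _ _ _ _ IH] by blast
        have "weakly_covered n ?E'"
          by (rule weakly_coveredI[OF cov, of _ b]) (use br d in auto)
        from IH[OF Un_upper1 P(2) ori(2) this] obtain Q where
          Q: "derives (L \<union> learned P) ?E' (edge_vars ?E') (root_clause n ?E') Q"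
            "num_clauses Q + 3 * cost * unlearned n (L \<union> learned P \<union> learned Q) \<le>
              D + 3 * cost * unlearned n (L \<union> learned P)"
          by blast
        define R where "R = resolve b a P Q"
        have lits: "xlit b a \<in> root_clause n ?E" "xlit a b \<in> root_clause n ?E'"
          using ac br d by auto
        have "derives L E (edge_vars E)
            ((root_clause n ?E - {xlit b a}) \<union> (root_clause n ?E' - {xlit a b})) R"
          unfolding R_def
        proof (rule derives_resolve)
          show "derives L E (insert (xvar b a) (edge_vars E)) (root_clause n ?E) P"
            using derives_drop_edge[OF P(1) lits(1)] by (simp add: xvar_commute[of b a])
          show "derives (L \<union> learned P) E (insert (xvar b a) (edge_vars E)) (root_clause n ?E') Q"
            using derives_drop_edge[OF Q(1) lits(2)] by simp
        qed (use d nE lits in auto)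
        then have "derives L E (edge_vars E) (root_clause n E) R"
        proof (rule derives_cong)
          show "root_clause n E \<subseteq>
              (root_clause n ?E - {xlit b a}) \<union> (root_clause n ?E' - {xlit a b})"
            using d nE ac br by (auto simp: root_clause_def negs_def)
          have "root_clause n ?E \<subseteq> negs ?E" "root_clause n ?E' \<subseteq> negs ?E'"
            by (rule root_clause_negs)+
          then show "(root_clause n ?E - {xlit b a}) \<union> (root_clause n ?E' - {xlit a b}) \<subseteq>
              root_clause n E \<union> negs E"
            by auto
        qed simp
        moreover have "num_clauses R + 3 * cost * unlearned n (L \<union> learned R) \<le>
            cost + 3 * cost * unlearned n L + 4 * (n * n - card E)"
        proof -
          have "3 * cost * unlearned n (L \<union> learned R) \<le>
              3 * cost * unlearned n (L \<union> learned P \<union> learned Q)"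
            using learned_resolve[of P Q b a]
            by (intro mult_le_mono2 unlearned_mono) (auto simp: R_def)
          moreover have "num_clauses R = num_clauses P + num_clauses Q + 1" by (simp add: R_def)
          moreover have "3 * D + 6 \<le> 4 * cost" by (simp add: D_def cost_def)
          ultimately show ?thesis using P(3) Q(2) by linarith
        qed
        ultimately show ?thesis by blast
      qed
    qed
  qed
qed

section \<open>The polynomial bound\<close>

lemma GGT_refutation:
  obtains P where "regRTI_refutation (GGT n r s) P" "num_clauses P \<le> 100 * (n + 1) ^ 7"
proof -
  have "roots n {} = {..<n}" by (auto simp: roots_def)
  then have "oriented n {}" "weakly_covered n {}"
    by (auto simp: oriented_def weakly_covered_def)
  from refute_weakly_covered[OF subset_refl this] obtain P where
    P: "derives (GGT n r s) {} (edge_vars {}) (root_clause n {}) P" and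
    size: "num_clauses P + 3 * cost * unlearned n (GGT n r s \<union> learned P) \<le>
      cost + 3 * cost * unlearned n (GGT n r s) + 4 * (n * n - card ({} :: (nat \<times> nat) set))"
    by blast
  have "regRTI_refutation (GGT n r s) P"
    using P by (intro regRTI_refutationI) (auto simp: derives_def root_clause_def negs_def)
  moreover have "num_clauses P \<le> 100 * (n + 1) ^ 7"
  proof -
    define N where "N = n + 1"
    have pow: "N ^ i \<le> N ^ j" if "i \<le> j" for i j
      using that by (intro power_increasing) (auto simp: N_def)
    have "n * n \<le> N ^ 2" "1 \<le> N ^ 4" by (auto simp: N_def power2_eq_square)
    \<comment> \<open>The coefficient is 12 + 7 + 2. The total below is then at most 3 * 21 + 25 =
      88 times \<open>N ^ 7\<close>, rounded up to 100.\<close>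
    with pow[of 2 4] have cost: "cost \<le> 21 * N ^ 4"
      unfolding cost_def N_def[symmetric] by linarith
    have "n * (n * n) \<le> N * (N * N)" by (intro mult_le_mono) (auto simp: N_def)
    then have "unlearned n (GGT n r s) \<le> N ^ 3"
      using unlearned_le[of n "GGT n r s"] by (simp add: power3_eq_cube)
    then have "cost * unlearned n (GGT n r s) \<le> 21 * N ^ 4 * N ^ 3"
      by (intro mult_le_mono cost)
    then have "cost * unlearned n (GGT n r s) \<le> 21 * N ^ 7"
      by (simp add: power_add[symmetric] mult.assoc)
    moreover have "cost + 4 * (n * n) \<le> 25 * N ^ 4"
      using cost \<open>n * n \<le> N ^ 2\<close> pow[of 2 4] by linarith
    moreover have "num_clauses P \<le> cost + 3 * cost * unlearned n (GGT n r s) + 4 * (n * n)"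
      using size by simp
    moreover have "N ^ 4 \<le> N ^ 7" by (rule pow) simp
    ultimately show ?thesis
      unfolding N_def[symmetric] by linarith
  qed
  ultimately show ?thesis using that by blast
qed

end

theorem theorem2:
  shows "\<exists>p :: real poly. \<forall>n>1. \<forall>r s. guards n r s \<longrightarrow>
           (\<exists>P. regRTI_refutation (GGT n r s) P \<and> real (num_clauses P) \<le> poly p (real n))"
proof (rule exI[of _ "smult 100 ([:1, 1:] ^ 7)"], intro allI impI)
  let ?p = "smult 100 ([:1, 1:] ^ 7) :: real poly"
  fix n :: nat and r s assume "n > 1" "guards n r s"
  then interpret guarded n r s by unfold_locales
  obtain P where P: "regRTI_refutation (GGT n r s) P" "num_clauses P \<le> 100 * (n + 1) ^ 7"
    by (rule GGT_refutation)
  have "real (num_clauses P) \<le> real (100 * (n + 1) ^ 7)"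
    using P(2) by (rule of_nat_mono)
  also have "\<dots> = poly ?p (real n)" by (simp add: add.commute)
  finally show "\<exists>P. regRTI_refutation (GGT n r s) P \<and> real (num_clauses P) \<le> poly ?p (real n)"
    using P(1) by blast
qed

end
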